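(* Let $\mu$ and $\nu$ be two probability measures on $\mathbb{R}$. Then there exist probability spaces $(\Omega_1,\mathcal{F}_1,\mathbb{P}_1)$ and $(\Omega_2,\mathcal{F}_2,\mathbb{P}_2)$, uniformly distributed random variables $X:\Omega_1\to[0,1]$ and $Y:\Omega_2\to[0,1]$, and a function $h:[0,1]\to\mathbb{R}$ such that $h(X)=h\circ X$ is measurable and has law $\mu$, and $h(Y)=h\circ Y$ is measurable and has law $\nu$.
   Context: $\mathcal{B}[0,1]$ denotes the Borel $\sigma$-algebra on $[0,1]$ and $\lambda$ denotes Lebesgue measure on $[0,1]$ restricted to Borel sets. A random variable $X:\Omega\to[0,1]$ on a probability space $(\Omega,\mathcal{F},\mathbb{P})$, i.e. a function measurable from $\mathcal{F}$ to $\mathcal{B}[0,1]$, is called uniformly distributed if $\mathbb{P}(X^{-1}(A))=\lambda(A)$ for all $A\in\mathcal{B}[0,1]$. Random variables may be defined on different probability spaces. Probability measures on $\mathbb{R}$ are Borel probability measures. The function $h$ is an arbitrary function (not required to be Borel or Lebesgue measurable); measurability of $h(X)$ means that $h\circ X:\Omega\to\mathbb{R}$ is measurable from $\mathcal{F}$ to the Borel $\sigma$-algebra of $\mathbb{R}$. *)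

theory Defs
  imports "HOL-Probability.Probability"
begin

abbreviation borel_01 :: "real measure" where
  "borel_01 \<equiv> restrict_space borel {0..1}"

abbreviation lebesgue_01 :: "real measure" where
  "lebesgue_01 \<equiv> restrict_space lborel {0..1}"

text \<open>The codomain is \<open>borel_01\<close>, so measurability of \<open>X\<close> includes that \<open>X\<close> maps
  \<open>space M\<close> into the unit interval.\<close>

definition uniformly_distributed :: "'a measure \<Rightarrow> ('a \<Rightarrow> real) \<Rightarrow> bool" where
  "uniformly_distributed M X \<longleftrightarrow>
     X \<in> measurable M borel_01 \<and>
     (\<forall>A \<in> sets borel_01. emeasure M (X -` A \<inter> space M) = emeasure lebesgue_01 A)"

end

theory Submission imports Defs begin

text \<open>
  There is a set \<open>A\<close> of reals such that both \<open>A\<close> and its complement meet every Borel subset of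
  positive measure of the unit interval. Both \<open>\<Omega>\<^sub>1 = A \<inter> (0, 1)\<close> and \<open>\<Omega>\<^sub>2 = (0, 1) - A\<close> then
  carry the trace of Lebesgue measure, a probability measure for which the inclusion into \<open>[0, 1]\<close>
  is uniformly distributed. As the two sets are disjoint, \<open>h\<close> may be the quantile function of \<open>\<mu>\<close>
  on \<open>\<Omega>\<^sub>1\<close> and that of \<open>\<nu>\<close> on \<open>\<Omega>\<^sub>2\<close>; each quantile function sends the uniform law to the
  prescribed one. The function \<open>h\<close> itself need not be measurable, since each of the two
  \<open>\<sigma>\<close>-algebras sees only its own half of \<open>h\<close>.

  For \<open>A\<close> one takes a variant of Vitali's construction, in which \<open>x \<in> A\<close> if and only if
  \<open>x + 1 / 3 ^ n \<notin> A\<close>, for all \<open>x\<close> and \<open>n\<close> (\<open>parity_set_exists\<close>). A Borel set \<open>B\<close> contained in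
  \<open>A\<close> or in its complement is then disjoint from its translates by the arbitrarily small numbers
  \<open>1 / 3 ^ n\<close>, which is only possible if \<open>B\<close> is null, by the argument of the Steinhaus theorem
  (\<open>null_if_disjoint_from_small_translates\<close>).
\<close>

section \<open>Traces of measures on thick sets\<close>

text \<open>The set \<open>A\<close> meets every measurable set of positive measure. For finite \<open>M\<close> and
  \<open>A \<subseteq> space M\<close> this says that \<open>A\<close> has full outer measure.\<close>

definition thick :: "'a measure \<Rightarrow> 'a set \<Rightarrow> bool" where
  "thick M A \<longleftrightarrow> (\<forall>B\<in>sets M. B \<inter> A = {} \<longrightarrow> emeasure M B = 0)"

text \<open>The trace of \<open>M\<close> on a set \<open>A\<close> that need not be measurable. For non-measurable \<open>A\<close>,
  the measure \<open>restrict_space M A\<close> has the right \<open>\<sigma>\<close>-algebra but not the right values, because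
  \<open>emeasure M\<close> vanishes on non-measurable sets; hence the outer measure.\<close>

definition trace_measure :: "'a measure \<Rightarrow> 'a set \<Rightarrow> 'a measure" where
  "trace_measure M A = measure_of (A \<inter> space M) ((\<inter>) A ` sets M) (outer_measure_of M)"

lemma space_trace_measure: "space (trace_measure M A) = A \<inter> space M"
  unfolding trace_measure_def by (rule space_measure_of) (auto dest: sets.sets_into_space)

lemma sets_trace_measure: "sets (trace_measure M A) = (\<inter>) A ` sets M"
proof -
  have "sets (trace_measure M A) = sets (restrict_space M A)"
    unfolding trace_measure_def restrict_space_def
    by (subst (1 2) sets_measure_of) (auto dest: sets.sets_into_space)
  then show ?thesis by (simp add: sets_restrict_space)
qed

lemma outer_measure_of_Int_thick:
  assumes "thick M A" and B: "B \<in> sets M"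
  shows "outer_measure_of M (A \<inter> B) = emeasure M B"
proof (rule antisym)
  show "outer_measure_of M (A \<inter> B) \<le> emeasure M B"
    using outer_measure_of_mono[of "A \<inter> B" B M] B by simp
  show "emeasure M B \<le> outer_measure_of M (A \<inter> B)"
    unfolding outer_measure_of_def
  proof (rule INF_greatest)
    fix C assume "C \<in> {C \<in> sets M. A \<inter> B \<subseteq> C}"
    then have C: "C \<in> sets M" and sub: "A \<inter> B \<subseteq> C" by auto
    have "emeasure M (B - C) = 0"
      using assms(1) B C sub unfolding thick_def by (blast intro: sets.Diff)
    then have "B - C \<in> null_sets M" using B C by (simp add: null_sets_def)
    then have "emeasure M (C \<union> (B - C)) = emeasure M C"
      using C by (rule emeasure_Un_null_set[rotated])
    then show "emeasure M B \<le> emeasure M C"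
      using emeasure_mono[of B "C \<union> (B - C)" M] B C by (metis Un_Diff_cancel Un_upper2 sets.Un)
  qed
qed

lemma emeasure_trace_measure:
  assumes th: "thick M A" and B: "B \<in> sets M"
  shows "emeasure (trace_measure M A) (A \<inter> B) = emeasure M B"
proof -
  have "emeasure (trace_measure M A) (A \<inter> B) = outer_measure_of M (A \<inter> B)"
  proof (rule emeasure_measure_of[OF trace_measure_def])
    show "(\<inter>) A ` sets M \<subseteq> Pow (A \<inter> space M)" by (auto dest: sets.sets_into_space)
    show "A \<inter> B \<in> sets (trace_measure M A)" using B by (simp add: sets_trace_measure)
    show "positive (sets (trace_measure M A)) (outer_measure_of M)"
      by (simp add: positive_def)
    show "countably_additive (sets (trace_measure M A)) (outer_measure_of M)"
    proof (rule countably_additiveI)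
      fix C :: "nat \<Rightarrow> 'a set"
      assume ran: "range C \<subseteq> sets (trace_measure M A)" and disj: "disjoint_family C"
      have "\<forall>i. \<exists>D\<in>sets M. C i = A \<inter> D"
        using ran unfolding sets_trace_measure by blast
      then obtain D where D: "\<And>i. D i \<in> sets M" "\<And>i. C i = A \<inter> D i" by metis
      \<comment> \<open>The \<open>D i\<close> overlap outside \<open>A\<close>; making them disjoint does not change their traces.\<close>
      have CD: "C i = A \<inter> disjointed D i" for i
      proof -
        have "C i \<inter> C j = {}" if "j < i" for j
          using disj that by (auto simp: disjoint_family_on_def)
        then show ?thesis unfolding disjointed_def D(2) by fastforce
      qed
      have sets: "range (disjointed D) \<subseteq> sets M"
        using D(1) by (intro sets.range_disjointed_sets) auto
      have "(\<Sum>i. outer_measure_of M (C i)) = (\<Sum>i. emeasure M (disjointed D i))"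
        unfolding CD using sets by (subst outer_measure_of_Int_thick[OF th]) auto
      also have "\<dots> = emeasure M (\<Union>i. disjointed D i)"
        using sets disjoint_family_disjointed by (rule suminf_emeasure)
      also have "\<dots> = outer_measure_of M (A \<inter> (\<Union>i. disjointed D i))"
        using sets by (subst outer_measure_of_Int_thick[OF th]) auto
      also have "A \<inter> (\<Union>i. disjointed D i) = (\<Union>i. C i)"
        unfolding CD by auto
      finally show "(\<Sum>i. outer_measure_of M (C i)) = outer_measure_of M (\<Union>i. C i)" .
    qed
  qed
  then show ?thesis using outer_measure_of_Int_thick[OF th B] by simp
qed

lemma measurable_ident_trace_measure: "(\<lambda>x. x) \<in> measurable (trace_measure M A) M"
proof (rule measurableI)
  fix B assume "B \<in> sets M"
  then have "(\<lambda>x. x) -` B \<inter> space (trace_measure M A) = A \<inter> B"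
    using sets.sets_into_space[of B M] by (auto simp: space_trace_measure)
  then show "(\<lambda>x. x) -` B \<inter> space (trace_measure M A) \<in> sets (trace_measure M A)"
    using \<open>B \<in> sets M\<close> by (simp add: sets_trace_measure)
qed (simp add: space_trace_measure)

lemma distr_trace_measure:
  assumes "thick M A"
  shows "distr (trace_measure M A) M (\<lambda>x. x) = M"
proof (rule measure_eqI)
  fix B assume "B \<in> sets (distr (trace_measure M A) M (\<lambda>x. x))"
  then have B: "B \<in> sets M" by simp
  then have "(\<lambda>x. x) -` B \<inter> space (trace_measure M A) = A \<inter> B"
    using sets.sets_into_space[of B M] by (auto simp: space_trace_measure)
  then show "emeasure (distr (trace_measure M A) M (\<lambda>x. x)) B = emeasure M B"
    using B by (simp add: emeasure_distr measurable_ident_trace_measure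
        emeasure_trace_measure[OF assms])
qed simp

section \<open>A set that is thick together with its complement\<close>

text \<open>A form of the Steinhaus theorem, by which the difference set of a set of positive measure
  contains a neighbourhood of \<open>0\<close>.\<close>

lemma null_if_disjoint_from_small_translates:
  fixes B :: "real set" and d :: "nat \<Rightarrow> real"
  assumes B: "B \<in> sets borel" "bounded B"
    and d: "d \<longlonglongrightarrow> 0"
    and disj: "\<And>n x. x \<in> B \<Longrightarrow> x + d n \<notin> B"
  shows "emeasure lborel B = 0"
proof (rule ccontr)
  assume pos: "emeasure lborel B \<noteq> 0"
  have fin: "emeasure lborel B < \<infinity>" using B(2) by (rule emeasure_bounded_finite)
  obtain K where K: "closed K" "K \<subseteq> B" "emeasure lborel K \<noteq> 0"
  proof -
    define e where "e = measure lborel B"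
    have e: "emeasure lborel B = ennreal e"
      using fin by (simp add: e_def emeasure_eq_ennreal_measure less_top)
    then have e_pos: "e > 0" using pos by (metis ennreal_eq_0_iff not_le)
    have "B \<in> sets lebesgue" using B(1) by simp
    then obtain K where K: "closed K" "K \<subseteq> B" "B - K \<in> lmeasurable"
        "emeasure lebesgue (B - K) < ennreal e"
      using e_pos by (rule sets_lebesgue_inner_closed)
    have "emeasure lborel K \<noteq> 0"
    proof
      assume "emeasure lborel K = 0"
      then have "K \<in> null_sets lborel" using K(1) by (simp add: null_sets_def)
      then have "emeasure lborel (B - K) = emeasure lborel B"
        using B(1) by (simp add: emeasure_Diff_null_set)
      moreover have "emeasure lebesgue (B - K) = emeasure lborel (B - K)"
        using B(1) K(1) by simp
      ultimately show False using K(4) e by simp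
    qed
    with K(1,2) show thesis by (rule that)
  qed
  have "bounded K" using K(2) B(2) bounded_subset by blast
  then have "compact K" using K(1) compact_eq_bounded_closed by blast
  have finK: "emeasure lborel K < \<infinity>" using \<open>bounded K\<close> by (rule emeasure_bounded_finite)
  define k where "k = measure lborel K"
  have k: "emeasure lborel K = ennreal k"
    using finK by (simp add: k_def emeasure_eq_ennreal_measure less_top)
  then have "k > 0" using K(3) by (metis ennreal_eq_0_iff not_le)
  with borel_closed[OF K(1)] obtain U where U: "open U" "K \<subseteq> U" "emeasure lborel (U - K) < ennreal k"
    by (rule outer_regular_lborel)
  obtain \<epsilon> where \<epsilon>: "\<epsilon> > 0" "(\<Union>x\<in>K. ball x \<epsilon>) \<subseteq> U"
    using compact_subset_open_imp_ball_epsilon_subset[OF \<open>compact K\<close> U(1,2)] by blast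
  obtain n where n: "\<bar>d n\<bar> < \<epsilon>"
    using LIMSEQ_D[OF d \<epsilon>(1)] by auto
  \<comment> \<open>The translate of \<open>K\<close> fits into \<open>U - K\<close>, which is too small for it.\<close>
  have sub: "(+) (d n) ` K \<subseteq> U - K"
  proof
    fix y assume "y \<in> (+) (d n) ` K"
    then obtain x where x: "x \<in> K" "y = x + d n" by auto
    then have "y \<in> ball x \<epsilon>" using n by (simp add: dist_real_def)
    then have "y \<in> U" using \<epsilon>(2) x(1) by blast
    moreover have "y \<notin> K" using disj[of x n] x K(2) by auto
    ultimately show "y \<in> U - K" by simp
  qed
  have "emeasure lborel K = emeasure (distr lborel borel ((+) (- d n))) K"
    by (simp add: lborel_distr_plus)
  also have "\<dots> = emeasure lborel ((+) (- d n) -` K)"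
    using K(1) by (subst emeasure_distr) auto
  also have "(+) (- d n) -` K = (+) (d n) ` K"
    by force
  also have "emeasure lborel \<dots> \<le> emeasure lborel (U - K)"
    using sub U(1) K(1) by (intro emeasure_mono) auto
  finally show False using U(3) k by simp
qed

text \<open>The group of all \<open>a / 3 ^ k\<close> has the index-two subgroup of those with even \<open>a\<close>,
  which contains no \<open>1 / 3 ^ n\<close>. Choosing a representative of every coset of the group, \<open>A\<close>
  collects the points whose offset from their representative lies in the subgroup.\<close>

lemma parity_set_exists:
  obtains A :: "real set" where "\<And>x n. x + 1 / 3 ^ n \<in> A \<longleftrightarrow> x \<notin> A"
proof -
  define S where "S = {x :: real. \<exists>a k. x = of_int a / 3 ^ k}"
  define E where "E = {x :: real. \<exists>a k. x = of_int (2 * a) / 3 ^ k}"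
  have E_iff: "of_int a / 3 ^ k \<in> E \<longleftrightarrow> even a" for a :: int and k :: nat
  proof
    assume "of_int a / 3 ^ k \<in> E"
    then obtain b j where "of_int a / 3 ^ k = (of_int (2 * b) / 3 ^ j :: real)"
      unfolding E_def by blast
    then have "(of_int (a * 3 ^ j) :: real) = of_int (2 * b * 3 ^ k)"
      by (simp add: field_simps)
    then have "a * 3 ^ j = 2 * b * 3 ^ k" by (simp only: of_int_eq_iff)
    then have "even (a * 3 ^ j)" by simp
    then show "even a" by simp
  next
    assume "even a"
    then obtain b where "a = 2 * b" by (elim evenE)
    then show "of_int a / 3 ^ k \<in> E" unfolding E_def by blast
  qed
  have sum: "of_int a / 3 ^ k + of_int b / 3 ^ n
      = (of_int (a * 3 ^ n + b * 3 ^ k) / 3 ^ (k + n) :: real)" for a b :: int and k n :: nat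
    by (simp add: add_divide_distrib power_add)
  have S_add: "s + of_int b / 3 ^ n \<in> S" if "s \<in> S" for s b n
    using that sum unfolding S_def by blast
  have flip: "s + 1 / 3 ^ n \<in> E \<longleftrightarrow> s \<notin> E" if s: "s \<in> S" for s n
  proof -
    obtain a k where a: "s = of_int a / 3 ^ k" using s unfolding S_def by blast
    have "s + 1 / 3 ^ n = of_int (a * 3 ^ n + 1 * 3 ^ k) / 3 ^ (k + n)"
      unfolding a using sum[of a k 1 n] by simp
    then show ?thesis unfolding a by (simp only: E_iff) simp
  qed
  define r where "r x = (SOME y. x - y \<in> S)" for x
  have "x - x \<in> S" for x unfolding S_def by (auto intro!: exI[of _ 0])
  then have r: "x - r x \<in> S" for x unfolding r_def by (rule someI)
  have r_shift: "r (x + 1 / 3 ^ n) = r x" for x n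
  proof -
    have "x + 1 / 3 ^ n - y \<in> S \<longleftrightarrow> x - y \<in> S" for y
    proof
      have eq: "x + 1 / 3 ^ n - y + of_int (- 1) / 3 ^ n = x - y" by simp
      show "x - y \<in> S" if "x + 1 / 3 ^ n - y \<in> S"
        using S_add[OF that, of "- 1" n] unfolding eq .
      have eq: "x - y + of_int 1 / 3 ^ n = x + 1 / 3 ^ n - y" by simp
      show "x + 1 / 3 ^ n - y \<in> S" if "x - y \<in> S"
        using S_add[OF that, of 1 n] unfolding eq .
    qed
    then show ?thesis unfolding r_def by simp
  qed
  show thesis
  proof (rule that[of "{x. x - r x \<in> E}"])
    fix x :: real and n :: nat
    have eq: "x + 1 / 3 ^ n - r x = (x - r x) + 1 / 3 ^ n" by simp
    show "x + 1 / 3 ^ n \<in> {x. x - r x \<in> E} \<longleftrightarrow> x \<notin> {x. x - r x \<in> E}"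
      using flip[OF r] by (simp only: mem_Collect_eq r_shift eq)
  qed
qed

text \<open>Lebesgue measure on the open interval, where the quantile functions are real-valued
  generalised inverses of distribution functions; the endpoints matter to neither law.\<close>

abbreviation unit_lborel :: "real measure" where
  "unit_lborel \<equiv> restrict_space lborel {0<..<1}"

lemma thick_parity_set:
  fixes A :: "real set"
  assumes A: "\<And>x n. x + 1 / 3 ^ n \<in> A \<longleftrightarrow> x \<notin> A"
  shows "thick unit_lborel A"
  unfolding thick_def
proof (intro ballI impI)
  fix B assume B: "B \<in> sets unit_lborel" and BA: "B \<inter> A = {}"
  have B': "B \<subseteq> {0<..<1}" "B \<in> sets borel"
    using B by (auto simp: sets_restrict_space_iff)
  have "emeasure lborel B = 0"
  proof (rule null_if_disjoint_from_small_translates)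
    show "bounded B" using B'(1) bounded_subset[of "{0<..<1}" B] by simp
    show "(\<lambda>n. 1 / 3 ^ n :: real) \<longlonglongrightarrow> 0"
      using LIMSEQ_realpow_zero[of "1/3"] by (simp add: power_one_over)
    show "x + 1 / 3 ^ n \<notin> B" if "x \<in> B" for n x
      using that A BA by blast
  qed fact
  then show "emeasure unit_lborel B = 0"
    using B' by (simp add: emeasure_restrict_space)
qed

section \<open>Uniform variables on thick subsets of the unit interval\<close>

lemma
  assumes th: "thick unit_lborel A"
  shows prob_space_trace_unit: "prob_space (trace_measure unit_lborel A)"
    and uniformly_distributed_trace_unit:
      "uniformly_distributed (trace_measure unit_lborel A) (\<lambda>x. x)"
proof -
  let ?T = "trace_measure unit_lborel A"
  have space: "space ?T = A \<inter> {0<..<1}"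
    by (simp add: space_trace_measure space_restrict_space)
  have "emeasure ?T (space ?T) = emeasure unit_lborel {0<..<1}"
    unfolding space by (rule emeasure_trace_measure[OF th]) (simp add: sets_restrict_space_iff)
  also have "\<dots> = 1" by (simp add: emeasure_restrict_space)
  finally show "prob_space ?T" by (rule prob_spaceI)
  have eq: "(\<lambda>x. x) -` S \<inter> space ?T = A \<inter> (S \<inter> {0<..<1})" for S :: "real set"
    by (auto simp: space)
  have sets: "S \<in> sets borel" "S \<inter> {0<..<1} \<in> sets unit_lborel" "S \<subseteq> {0..1}"
    if "S \<in> sets borel_01" for S
    using that by (auto simp: sets_restrict_space_iff)
  show "uniformly_distributed ?T (\<lambda>x. x)"
    unfolding uniformly_distributed_def
  proof (intro conjI ballI)
    show "(\<lambda>x. x) \<in> measurable ?T borel_01"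
    proof (rule measurableI)
      show "(\<lambda>x. x) -` S \<inter> space ?T \<in> sets ?T" if "S \<in> sets borel_01" for S
        unfolding eq sets_trace_measure using sets[OF that] by blast
    qed (auto simp: space space_restrict_space)
    fix S :: "real set" assume S: "S \<in> sets borel_01"
    have "emeasure ?T ((\<lambda>x. x) -` S \<inter> space ?T) = emeasure unit_lborel (S \<inter> {0<..<1})"
      unfolding eq using sets(2)[OF S] by (rule emeasure_trace_measure[OF th])
    also have "\<dots> = emeasure lborel (S \<inter> {0<..<1})"
      by (simp add: emeasure_restrict_space)
    also have "\<dots> = emeasure lborel S"
      \<comment> \<open>Only the endpoints \<open>0\<close> and \<open>1\<close> are lost.\<close>
    proof (rule emeasure_eq_AE)
      show "AE x in lborel. x \<in> S \<inter> {0<..<1} \<longleftrightarrow> x \<in> S"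
        using AE_lborel_singleton[of 0] AE_lborel_singleton[of 1]
        by eventually_elim (use sets(3)[OF S] in force)
    qed (use sets(1)[OF S] in auto)
    also have "\<dots> = emeasure lebesgue_01 S"
      using sets(3)[OF S] by (simp add: emeasure_restrict_space)
    finally show "emeasure ?T ((\<lambda>x. x) -` S \<inter> space ?T) = emeasure lebesgue_01 S" .
  qed
qed

text \<open>The trace of the uniform law on \<open>A\<close> sees only the values of \<open>h\<close> on \<open>A\<close>, so \<open>h\<close> has
  the law of the measurable function \<open>q\<close> that it agrees with there.\<close>

lemma law_on_trace_unit:
  fixes q h :: "real \<Rightarrow> real"
  assumes th: "thick unit_lborel A"
    and q: "q \<in> borel_measurable unit_lborel" "distr unit_lborel borel q = \<mu>"
    and h: "\<And>x. x \<in> A \<Longrightarrow> h x = q x"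
  shows "h \<in> borel_measurable (trace_measure unit_lborel A)"
    and "distr (trace_measure unit_lborel A) borel h = \<mu>"
proof -
  let ?T = "trace_measure unit_lborel A"
  have hq: "h x = q x" if "x \<in> space ?T" for x
    using that h by (simp add: space_trace_measure)
  have "q \<in> borel_measurable ?T"
    using measurable_compose[OF measurable_ident_trace_measure q(1)] .
  then show "h \<in> borel_measurable ?T"
    using hq by (subst measurable_cong[of _ h q]) auto
  have "distr ?T borel h = distr ?T borel q"
    using hq by (intro distr_cong) auto
  also have "\<dots> = distr (distr ?T unit_lborel (\<lambda>x. x)) borel q"
    using distr_distr[OF q(1) measurable_ident_trace_measure] by (simp add: comp_def)
  also have "\<dots> = \<mu>" using q(2) by (simp add: distr_trace_measure[OF th])
  finally show "distr ?T borel h = \<mu>" .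
qed

lemma quantile_function_exists:
  assumes "real_distribution \<mu>"
  obtains q :: "real \<Rightarrow> real"
  where "q \<in> borel_measurable unit_lborel" "distr unit_lborel borel q = \<mu>"
proof -
  interpret cdf_distribution \<mu> unfolding cdf_distribution_def by (rule assms)
  have "sets unit_lborel = sets (restrict_space borel {0<..<1})"
    by (rule sets_restrict_space_cong) simp
  then have "I \<in> borel_measurable unit_lborel"
    using measurable_CI measurable_cong_sets by blast
  then show thesis using distr_I_eq_M by (rule that)
qed

theorem theorem1:
  fixes \<mu> \<nu> :: "real measure"
  assumes "real_distribution \<mu>" and "real_distribution \<nu>"
  shows "\<exists>(M1 :: real measure) (M2 :: real measure) (X :: real \<Rightarrow> real) (Y :: real \<Rightarrow> real)
           (h :: real \<Rightarrow> real).
         prob_space M1 \<and> prob_space M2 \<and>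
         uniformly_distributed M1 X \<and> uniformly_distributed M2 Y \<and>
         h \<circ> X \<in> borel_measurable M1 \<and> distr M1 borel (h \<circ> X) = \<mu> \<and>
         h \<circ> Y \<in> borel_measurable M2 \<and> distr M2 borel (h \<circ> Y) = \<nu>"
proof -
  obtain A :: "real set" where A: "\<And>x n. x + 1 / 3 ^ n \<in> A \<longleftrightarrow> x \<notin> A"
    using parity_set_exists by blast
  have th: "thick unit_lborel A" "thick unit_lborel (- A)"
    using A by (auto intro!: thick_parity_set)
  obtain q where q: "q \<in> borel_measurable unit_lborel" "distr unit_lborel borel q = \<mu>"
    using quantile_function_exists[OF assms(1)] by blast
  obtain q' where q': "q' \<in> borel_measurable unit_lborel" "distr unit_lborel borel q' = \<nu>"
    using quantile_function_exists[OF assms(2)] by blast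
  define h where "h x = (if x \<in> A then q x else q' x)" for x
  have h: "h x = q x" if "x \<in> A" for x using that by (simp add: h_def)
  have h': "h x = q' x" if "x \<in> - A" for x using that by (simp add: h_def)
  let ?M1 = "trace_measure unit_lborel A" and ?M2 = "trace_measure unit_lborel (- A)"
  show ?thesis
  proof (intro exI conjI)
    show "prob_space ?M1" "prob_space ?M2"
      using th by (simp_all add: prob_space_trace_unit)
    show "uniformly_distributed ?M1 (\<lambda>x. x)" "uniformly_distributed ?M2 (\<lambda>x. x)"
      using th by (simp_all add: uniformly_distributed_trace_unit)
    show "h \<circ> (\<lambda>x. x) \<in> borel_measurable ?M1" "distr ?M1 borel (h \<circ> (\<lambda>x. x)) = \<mu>"
      using law_on_trace_unit[OF th(1) q, of h] h by (simp_all add: comp_def)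
    show "h \<circ> (\<lambda>x. x) \<in> borel_measurable ?M2" "distr ?M2 borel (h \<circ> (\<lambda>x. x)) = \<nu>"
      using law_on_trace_unit[OF th(2) q', of h] h' by (simp_all add: comp_def)
  qed
qed

end
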